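(* Let $k=k(n)$. For almost all Boolean functions $f$ of the class $P_k^n$ (i.e. the fraction of functions in $P_k^n$ for which the property fails tends to $0$ as $n\to\infty$), no disjunctive normal form of $f$ consisting only of prime implicants contains an implicant of rank $d$, whenever $d$ lies outside the interval $\left[\log k + O(\log\log k + \log\log n);\ \log (nk) - \Omega(\log\log (nk))\right]$.
   Context: $P_k^n$ denotes the class of Boolean functions $f:\{0,1\}^n\to\{0,1\}$ that have exactly $k$ zeros (points where $f=0$). A literal is a Boolean variable $x_i$ or its negation; an elementary conjunction is a product of literals over distinct variables, and its rank is the number of literals in it. A disjunctive normal form (DNF) of $f$ is a disjunction of elementary conjunctions equal to $f$. A conjunction $K$ is an implicant of $f$ if the set of points where $K=1$ is contained in the set of points where $f=1$; it is a prime implicant if deleting any literal from $K$ yields a conjunction that is no longer an implicant of $f$. $\log$ denotes the natural logarithm, and the asymptotic notations $O(\cdot)$, $\Omega(\cdot)$ refer to $n\to\infty$.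
   Formalization: All logarithms are taken to base 2 instead of natural: with natural logarithms the claim fails, e.g. for k = 2^(n-1), where almost all f have only prime implicants of rank above n - 2 log_2 n > ln(nk); also k(n) ≤ 2^n is assumed so that the class is nonempty. *)

theory Defs
  imports Complex_Main "HOL-Library.FuncSet" "HOL-Library.Landau_Symbols"
begin

definition cube :: "nat \<Rightarrow> bool list set" where
  "cube n = {x. length x = n}"

text \<open>Boolean functions are extensional on the cube, so that distinct elements of the class
  below are distinct functions of \<open>n\<close> variables and the class is finite.\<close>

definition P :: "nat \<Rightarrow> nat \<Rightarrow> (bool list \<Rightarrow> bool) set" where
  "P n k = {f \<in> cube n \<rightarrow>\<^sub>E UNIV. card {x \<in> cube n. \<not> f x} = k}"

text \<open>Variables are numbered from 0; the variables of an \<open>n\<close>-ary function are \<open>{..<n}\<close>.\<close>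

datatype literal = Pos (var: nat) | Neg (var: nat)

fun lit_true :: "literal \<Rightarrow> bool list \<Rightarrow> bool" where
  "lit_true (Pos i) x \<longleftrightarrow> x ! i"
| "lit_true (Neg i) x \<longleftrightarrow> \<not> x ! i"

text \<open>An elementary conjunction is the set of its literals. The empty conjunction (rank 0,
  constantly true) is included.\<close>

definition elementary_conjunction :: "nat \<Rightarrow> literal set \<Rightarrow> bool" where
  "elementary_conjunction n K \<longleftrightarrow> var ` K \<subseteq> {..<n} \<and> inj_on var K"

definition rank :: "literal set \<Rightarrow> nat" where
  "rank K = card K"

definition conj_true :: "literal set \<Rightarrow> bool list \<Rightarrow> bool" where
  "conj_true K x \<longleftrightarrow> (\<forall>l\<in>K. lit_true l x)"

definition implicant :: "nat \<Rightarrow> (bool list \<Rightarrow> bool) \<Rightarrow> literal set \<Rightarrow> bool" where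
  "implicant n f K \<longleftrightarrow> elementary_conjunction n K \<and>
     {x \<in> cube n. conj_true K x} \<subseteq> {x \<in> cube n. f x}"

definition prime_implicant :: "nat \<Rightarrow> (bool list \<Rightarrow> bool) \<Rightarrow> literal set \<Rightarrow> bool" where
  "prime_implicant n f K \<longleftrightarrow> implicant n f K \<and> (\<forall>l\<in>K. \<not> implicant n f (K - {l}))"

definition is_dnf :: "nat \<Rightarrow> (bool list \<Rightarrow> bool) \<Rightarrow> literal set set \<Rightarrow> bool" where
  "is_dnf n f D \<longleftrightarrow> (\<forall>K\<in>D. elementary_conjunction n K) \<and>
     (\<forall>x\<in>cube n. f x \<longleftrightarrow> (\<exists>K\<in>D. conj_true K x))"

definition almost_all :: "(nat \<Rightarrow> 'a set) \<Rightarrow> (nat \<Rightarrow> 'a \<Rightarrow> bool) \<Rightarrow> bool" where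
  "almost_all A Q \<longleftrightarrow>
     (\<lambda>n. real (card {f \<in> A n. \<not> Q n f}) / real (card (A n))) \<longlonglongrightarrow> 0"

text \<open>Logarithms are binary. No other base makes the rank bounds correct: for
  \<open>k = 2 ^ (n - 1)\<close> almost all functions have only implicants of rank at least
  \<open>n - 2 * log 2 n\<close>, which exceeds \<open>ln (n * k)\<close>.\<close>

abbreviation lg :: "real \<Rightarrow> real" where
  "lg x \<equiv> log 2 x"

end

theory Submission
  imports Defs "HOL-Real_Asymp.Real_Asymp"
begin

text \<open>
  The zero set of a random function in \<open>P n k\<close> is a uniformly random \<open>k\<close>-subset of the cube, and
  both ends of the interval come from first moment bounds. A fixed conjunction of rank \<open>d\<close> is an
  implicant with probability at most \<open>(1 - 2^-d)^k\<close>, so the expected number of implicants of rank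
  \<open>d\<close> is at most \<open>(2n)^d exp (- k / 2^d)\<close>. If a conjunction of rank \<open>d\<close> is a prime implicant, then
  each of the \<open>d\<close> disjoint subcubes obtained by negating one literal contains a zero, which has
  probability at most \<open>(k / 2^d)^d\<close>; the expected number of prime implicants of rank \<open>d\<close> is thus at
  most \<open>(2n)^d / d! * (k / 2^d)^d \<le> (2 e n k / (d 2^d))^d\<close>. The factor \<open>d\<close> in the last denominator
  yields the gain \<open>lg (lg (n k))\<close> below \<open>lg (n k)\<close>.
\<close>

section \<open>Subsets of prescribed size\<close>

lemma Suc_times_binomial_Suc: "Suc k * (n choose Suc k) = (n - k) * (n choose k)"
  by (simp only: binomial_absorption binomial_absorb_comp)

text \<open>The quotient of the two binomials is a product of factors
  \<open>(a - i) / (N - i)\<close>, each at most \<open>a / N\<close> because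
  \<open>a \<le> N\<close>. In effect, drawing without replacement is compared with drawing with
  replacement.\<close>

lemma binomial_mult_power_le:
  fixes a N k :: nat
  assumes "a \<le> N"
  shows "(a choose k) * N ^ k \<le> (N choose k) * a ^ k"
proof (induction k)
  case (Suc k)
  have "(a - k) * N \<le> (N - k) * a"
    using mult_le_mono2[OF assms, of k] by (simp add: diff_mult_distrib mult.commute[of a N] diff_le_mono2)
  then have "((a choose k) * N ^ k) * ((a - k) * N) \<le> ((N choose k) * a ^ k) * ((N - k) * a)"
    using mult_le_mono[OF Suc] by blast
  then have "((a - k) * (a choose k)) * N ^ Suc k \<le> ((N - k) * (N choose k)) * a ^ Suc k"
    by (simp add: algebra_simps)
  then show ?case
    by (simp only: mult.assoc Suc_mult_le_cancel1 flip: Suc_times_binomial_Suc)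
qed simp

text \<open>The sets counted are the \<open>k\<close>-subsets of \<open>U - A\<close>, so
  \<open>binomial_mult_power_le\<close> applies with \<open>a = card U - card A\<close>.\<close>

lemma card_subsets_disjoint_le:
  assumes "finite U" "A \<subseteq> U" "U \<noteq> {}"
  shows "real (card {Z. Z \<subseteq> U \<and> card Z = k \<and> Z \<inter> A = {}})
    \<le> real (card U choose k) * (1 - real (card A) / real (card U)) ^ k"
proof -
  have N: "card U > 0" and A: "finite A" "card A \<le> card U"
    using assms by (auto simp: card_gt_0_iff finite_subset card_mono)
  have "{Z. Z \<subseteq> U \<and> card Z = k \<and> Z \<inter> A = {}} = {Z. Z \<subseteq> U - A \<and> card Z = k}"
    by auto
  then have "card {Z. Z \<subseteq> U \<and> card Z = k \<and> Z \<inter> A = {}} = (card U - card A choose k)"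
    using assms A by (simp add: n_subsets card_Diff_subset)
  moreover have "real (card U - card A choose k) * real (card U) ^ k
      \<le> real (card U choose k) * real (card U - card A) ^ k"
    using binomial_mult_power_le[of "card U - card A" "card U" k]
    by (simp flip: of_nat_mult of_nat_power)
  ultimately show ?thesis
    using N A by (simp add: divide_simps)
qed

text \<open>With \<open>s = card S\<close> and \<open>N = card U\<close>, deleting \<open>S\<close>
  leaves a \<open>(k - s)\<close>-subset of \<open>U - S\<close>. By \<open>(N choose s) * (N - s
  choose (k - s)) = (N choose k) * (k choose s)\<close> the proportion is at most
  \<open>(k choose s) / (N choose s)\<close>, and \<open>binomial_mult_power_le\<close> applies with
  \<open>k\<close> in the role of \<open>a\<close>.\<close>

lemma card_supersets_le:
  assumes "finite U" "S \<subseteq> U" "k \<le> card U" "U \<noteq> {}"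
  shows "real (card {Z. Z \<subseteq> U \<and> card Z = k \<and> S \<subseteq> Z})
    \<le> real (card U choose k) * (real k / real (card U)) ^ card S"
proof (cases "card S \<le> k")
  \<comment> \<open>Here nothing is counted; separating this case keeps \<open>k - card S\<close>
    from being truncated below.\<close>
  case False
  then have "{Z. Z \<subseteq> U \<and> card Z = k \<and> S \<subseteq> Z} = {}"
    using assms(1) card_mono finite_subset by blast
  then show ?thesis by (simp only: card.empty) simp
next
  case True
  let ?s = "card S" and ?N = "card U"
  have N: "?N > 0" and S: "finite S" "?s \<le> ?N"
    using assms by (auto simp: card_gt_0_iff finite_subset card_mono)
  have "inj_on (\<lambda>Z. Z - S) {Z. Z \<subseteq> U \<and> card Z = k \<and> S \<subseteq> Z}"
    by (auto simp: inj_on_def)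
  moreover have "(\<lambda>Z. Z - S) ` {Z. Z \<subseteq> U \<and> card Z = k \<and> S \<subseteq> Z} \<subseteq> {Z. Z \<subseteq> U - S \<and> card Z = k - ?s}"
    using S by (auto simp: card_Diff_subset)
  ultimately have "card {Z. Z \<subseteq> U \<and> card Z = k \<and> S \<subseteq> Z} \<le> card {Z. Z \<subseteq> U - S \<and> card Z = k - ?s}"
    using assms(1) by (intro card_inj_on_le) auto
  also have "\<dots> = (?N - ?s choose (k - ?s))"
    using assms S by (simp add: n_subsets card_Diff_subset)
  finally have *: "card {Z. Z \<subseteq> U \<and> card Z = k \<and> S \<subseteq> Z} \<le> (?N - ?s choose (k - ?s))" .
  have "(?N choose ?s) * ((?N - ?s choose (k - ?s)) * ?N ^ ?s) = (?N choose k) * ((k choose ?s) * ?N ^ ?s)"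
    using choose_mult[OF True assms(3)] by (simp add: algebra_simps)
  also have "\<dots> \<le> (?N choose k) * ((?N choose ?s) * k ^ ?s)"
    using binomial_mult_power_le[OF assms(3)] by (intro mult_le_mono2)
  also have "\<dots> = (?N choose ?s) * ((?N choose k) * k ^ ?s)"
    by (simp add: algebra_simps)
  finally have "(?N - ?s choose (k - ?s)) * ?N ^ ?s \<le> (?N choose k) * k ^ ?s"
    using S by (simp only: nat_mult_le_cancel_disj zero_less_binomial_iff)
  then have "card {Z. Z \<subseteq> U \<and> card Z = k \<and> S \<subseteq> Z} * ?N ^ ?s \<le> (?N choose k) * k ^ ?s"
    using mult_le_mono1[OF *] order_trans by blast
  then have "real (card {Z. Z \<subseteq> U \<and> card Z = k \<and> S \<subseteq> Z}) * real ?N ^ ?s \<le> real (?N choose k) * real k ^ ?s"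
    by (simp only: of_nat_le_iff flip: of_nat_mult of_nat_power)
  then show ?thesis
    using N by (simp add: divide_simps)
qed

section \<open>Subcubes\<close>

lemma finite_cube [simp]: "finite (cube n)"
  and card_cube [simp]: "card (cube n) = 2 ^ n"
  using card_lists_length_eq[of "UNIV :: bool set" n] finite_lists_length_eq[of "UNIV :: bool set" n]
  by (simp_all add: cube_def)

lemma cube_nonempty [simp]: "cube n \<noteq> {}"
  by (metis card_cube card.empty power_not_zero zero_neq_numeral)

definition subcube :: "nat \<Rightarrow> literal set \<Rightarrow> bool list set" where
  "subcube n K = {x \<in> cube n. conj_true K x}"

lemma finite_subcube [simp]: "finite (subcube n K)"
  by (simp add: subcube_def)

lemma subcube_subset: "subcube n K \<subseteq> cube n"
  by (auto simp: subcube_def)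

lemma finite_elementary_conjunction: "elementary_conjunction n K \<Longrightarrow> finite K"
  unfolding elementary_conjunction_def by (metis finite_imageD finite_lessThan finite_subset)

lemma rank_le_if_elementary_conjunction: "elementary_conjunction n K \<Longrightarrow> rank K \<le> n"
  unfolding elementary_conjunction_def rank_def
  by (metis card_image card_lessThan card_mono finite_lessThan)

lemma elementary_conjunction_mono:
  "elementary_conjunction n K \<Longrightarrow> L \<subseteq> K \<Longrightarrow> elementary_conjunction n L"
  unfolding elementary_conjunction_def by (meson image_mono inj_on_subset order_trans)

lemma lit_true_flip:
  assumes "i < length x"
  shows "lit_true l (x[i := \<not> x ! i]) \<longleftrightarrow> (if var l = i then \<not> lit_true l x else lit_true l x)"
  using assms by (cases l) auto

text \<open>Flipping the coordinate \<open>var l\<close> is an involution that exchanges the points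
  falsifying \<open>l\<close> with those satisfying it. The literals of \<open>K\<close> do not
  notice, since their variables differ from \<open>var l\<close>.\<close>

lemma card_subcube_half:
  assumes "elementary_conjunction n (insert l K)" "l \<notin> K"
  shows "card {x \<in> subcube n K. \<not> lit_true l x} = card (subcube n (insert l K))"
proof (rule bij_betw_same_card)
  let ?flip = "\<lambda>x. x[var l := \<not> x ! var l]"
  have K: "var l' \<noteq> var l" if "l' \<in> K" for l'
    using assms that unfolding elementary_conjunction_def by (metis inj_onD insertCI)
  have l: "var l < n"
    using assms by (auto simp: elementary_conjunction_def)
  show "bij_betw ?flip {x \<in> subcube n K. \<not> lit_true l x} (subcube n (insert l K))"
    using l K by (intro bij_betwI[where g = ?flip])
      (auto simp: subcube_def cube_def conj_true_def lit_true_flip)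
qed

lemma card_subcube:
  assumes "elementary_conjunction n K"
  shows "card (subcube n K) * 2 ^ card K = 2 ^ n"
  using finite_elementary_conjunction[OF assms] assms
proof (induction K rule: finite_induct)
  case empty
  then show ?case by (simp add: subcube_def conj_true_def)
next
  case (insert l K)
  have "subcube n K = subcube n (insert l K) \<union> {x \<in> subcube n K. \<not> lit_true l x}"
    by (auto simp: subcube_def conj_true_def)
  moreover have "subcube n (insert l K) \<inter> {x \<in> subcube n K. \<not> lit_true l x} = {}"
    by (auto simp: subcube_def conj_true_def)
  ultimately have "card (subcube n K) = card (subcube n (insert l K)) + card {x \<in> subcube n K. \<not> lit_true l x}"
    by (metis card_Un_disjoint finite_Un finite_subcube)
  then have "card (subcube n K) = 2 * card (subcube n (insert l K))"
    using card_subcube_half[of n l K] insert by simp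
  then show ?case
    using insert elementary_conjunction_mono[OF insert.prems, of K] by (simp add: subset_insertI)
qed

lemma card_subcube_real:
  assumes "elementary_conjunction n K"
  shows "real (card (subcube n K)) = 2 ^ n / 2 ^ card K"
proof -
  have "real (card (subcube n K)) * 2 ^ card K = 2 ^ n"
    using card_subcube[OF assms] by (metis of_nat_mult of_nat_numeral of_nat_power)
  then show ?thesis by (simp add: field_simps)
qed

section \<open>The number of conjunctions of a given rank\<close>

definition conjunctions :: "nat \<Rightarrow> nat \<Rightarrow> literal set set" where
  "conjunctions n d = {K. elementary_conjunction n K \<and> rank K = d}"

lemma conjunctions_subset:
  "conjunctions n d \<subseteq> {K. K \<subseteq> Pos ` {..<n} \<union> Neg ` {..<n} \<and> card K = d}"
proof -
  have "l \<in> Pos ` {..<n} \<union> Neg ` {..<n}" if "var l < n" for l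
    using that by (cases l) auto
  then show ?thesis
    by (fastforce simp: conjunctions_def elementary_conjunction_def rank_def)
qed

lemma finite_conjunctions [simp]: "finite (conjunctions n d)"
  by (rule finite_subset[OF conjunctions_subset]) simp

text \<open>Conjunctions of rank \<open>d\<close> are among the \<open>d\<close>-subsets of the
  \<open>2 * n\<close> literals, contradictory sets included. The factor \<open>fact d\<close> is
  kept because the upper end of the interval depends on it.\<close>

lemma card_conjunctions_le: "real (card (conjunctions n d)) \<le> (2 * real n) ^ d / fact d"
proof -
  have "card (Pos ` {..<n} \<union> Neg ` {..<n}) = 2 * n"
    by (subst card_Un_disjoint) (auto simp: card_image inj_on_def)
  then have "card (conjunctions n d) \<le> (2 * n choose d)"
    using card_mono[OF _ conjunctions_subset[of n d]] by (simp add: n_subsets)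
  then have "card (conjunctions n d) * fact d \<le> (2 * n) ^ d"
    using binomial_fact_pow[of "2 * n" d] mult_le_mono1 order_trans by blast
  then have "real (card (conjunctions n d) * fact d) \<le> real ((2 * n) ^ d)"
    by (simp only: of_nat_le_iff)
  then show ?thesis by (simp add: field_simps)
qed

section \<open>Expected numbers of implicants\<close>

definition zeros :: "nat \<Rightarrow> (bool list \<Rightarrow> bool) \<Rightarrow> bool list set" where
  "zeros n f = {x \<in> cube n. \<not> f x}"

text \<open>Extensionality on the cube makes the zero set determine the function, so a random
  function of the class is a uniformly random \<open>k\<close>-subset.\<close>

lemma bij_betw_zeros: "bij_betw (zeros n) (P n k) {Z. Z \<subseteq> cube n \<and> card Z = k}"
proof (rule bij_betwI[where g = "\<lambda>Z. restrict (\<lambda>x. x \<notin> Z) (cube n)"])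
  show "zeros n \<in> P n k \<rightarrow> {Z. Z \<subseteq> cube n \<and> card Z = k}"
    by (auto simp: zeros_def P_def)
  have zeros: "zeros n (restrict (\<lambda>x. x \<notin> Z) (cube n)) = Z" if "Z \<subseteq> cube n" for Z
    using that by (auto simp: zeros_def)
  then show "(\<lambda>Z. restrict (\<lambda>x. x \<notin> Z) (cube n)) \<in> {Z. Z \<subseteq> cube n \<and> card Z = k} \<rightarrow> P n k"
    unfolding P_def zeros_def by fastforce
  show "zeros n (restrict (\<lambda>x. x \<notin> Z) (cube n)) = Z" if "Z \<in> {Z. Z \<subseteq> cube n \<and> card Z = k}" for Z
    using that zeros by blast
  show "restrict (\<lambda>x. x \<notin> zeros n f) (cube n) = f" if "f \<in> P n k" for f
    using that by (auto simp: P_def zeros_def fun_eq_iff PiE_def extensional_def)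
qed

lemma card_P: "card (P n k) = (2 ^ n choose k)"
  using bij_betw_same_card[OF bij_betw_zeros[of n k]] by (simp add: n_subsets)

lemma finite_P [simp]: "finite (P n k)"
  using bij_betw_finite[OF bij_betw_zeros[of n k]] by simp

text \<open>Turns counting functions into counting \<open>k\<close>-subsets. An implication from
  \<open>R\<close> to \<open>Q\<close> suffices for upper bounds; for prime implicants
  \<open>Q\<close> will be weaker than \<open>R\<close>.\<close>

lemma card_P_zeros_le:
  assumes "\<And>f. f \<in> P n k \<Longrightarrow> R f \<Longrightarrow> Q (zeros n f)"
  shows "card {f \<in> P n k. R f} \<le> card {Z. Z \<subseteq> cube n \<and> card Z = k \<and> Q Z}"
proof (rule card_inj_on_le)
  show "inj_on (zeros n) {f \<in> P n k. R f}"
    using bij_betw_zeros[of n k] by (auto simp: bij_betw_def inj_on_def)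
  show "zeros n ` {f \<in> P n k. R f} \<subseteq> {Z. Z \<subseteq> cube n \<and> card Z = k \<and> Q Z}"
    using bij_betwE[OF bij_betw_zeros[of n k]] assms by auto
  show "finite {Z. Z \<subseteq> cube n \<and> card Z = k \<and> Q Z}"
    by (rule finite_subset[of _ "Pow (cube n)"]) auto
qed

lemma implicant_iff_zeros:
  "implicant n f K \<longleftrightarrow> elementary_conjunction n K \<and> zeros n f \<inter> subcube n K = {}"
  by (auto simp: implicant_def zeros_def subcube_def)

lemma card_implicant_le:
  assumes "elementary_conjunction n K"
  shows "real (card {f \<in> P n k. implicant n f K}) \<le> real (card (P n k)) * (1 - 1 / 2 ^ card K) ^ k"
proof -
  have "card {f \<in> P n k. implicant n f K} \<le> card {Z. Z \<subseteq> cube n \<and> card Z = k \<and> Z \<inter> subcube n K = {}}"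
    by (rule card_P_zeros_le) (simp add: implicant_iff_zeros)
  also have "real \<dots> \<le> real (card (P n k)) * (1 - 1 / 2 ^ card K) ^ k"
    using card_subsets_disjoint_le[OF finite_cube subcube_subset cube_nonempty, of n k K]
    by (simp add: card_P card_subcube_real[OF assms])
  finally show ?thesis by simp
qed

text \<open>Union bound over the ways to pick one zero from each subcube with a single literal
  negated. With \<open>d = card K\<close> there are \<open>(2 ^ (n - d)) ^ d\<close> choices, and
  \<open>d\<close> fixed points are all zeros with probability at most
  \<open>(k / 2 ^ n) ^ d\<close>.\<close>

lemma card_prime_implicant_le:
  assumes K: "elementary_conjunction n K" and k: "k \<le> 2 ^ n"
  shows "real (card {f \<in> P n k. prime_implicant n f K})
    \<le> real (card (P n k)) * (real k / 2 ^ card K) ^ card K"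
proof -
  \<comment> \<open>\<open>N l\<close> is the subcube of \<open>K\<close> with \<open>l\<close>
    negated, and \<open>F\<close> consists of the ways to pick one point from each.\<close>
  define N where "N l = {x \<in> subcube n (K - {l}). \<not> lit_true l x}" for l
  define F where "F = PiE K N"
  have fin: "finite K" using K by (rule finite_elementary_conjunction)
  have card_N: "card (N l) = card (subcube n K)" if "l \<in> K" for l
    using card_subcube_half[of n l "K - {l}"] K that by (simp add: N_def insert_absorb)
  have finite_F: "finite F"
    unfolding F_def using fin by (intro finite_PiE) (auto simp: N_def)
  have card_F: "card F = card (subcube n K) ^ card K"
    unfolding F_def using fin card_N by (simp add: card_PiE)
  have image: "\<phi> ` K \<subseteq> cube n \<and> card (\<phi> ` K) = card K" if "\<phi> \<in> F" for \<phi>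
  proof
    have \<phi>: "\<phi> l \<in> N l" if "l \<in> K" for l
      using \<open>\<phi> \<in> F\<close> that by (auto simp: F_def)
    then show "\<phi> ` K \<subseteq> cube n"
      by (auto simp: N_def subcube_def)
    \<comment> \<open>The sets \<open>N l\<close> are pairwise disjoint: a point of
      \<open>N l\<close> falsifies \<open>l\<close>, whereas a point of \<open>N l'\<close> with
      \<open>l' \<noteq> l\<close> satisfies it.\<close>
    have "inj_on \<phi> K"
    proof (rule inj_onI, rule ccontr)
      fix l l' assume "l \<in> K" "l' \<in> K" "\<phi> l = \<phi> l'" "l \<noteq> l'"
      then show False
        using \<phi>[of l] \<phi>[of l'] by (auto simp: N_def subcube_def conj_true_def)
    qed
    then show "card (\<phi> ` K) = card K"
      by (rule card_image)
  qed
  have "\<exists>\<phi>\<in>F. \<phi> ` K \<subseteq> zeros n f" if f: "prime_implicant n f K" for f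
  proof -
    have "\<exists>x \<in> N l. x \<in> zeros n f" if "l \<in> K" for l
    proof -
      have "elementary_conjunction n (K - {l})"
        using K by (rule elementary_conjunction_mono) auto
      moreover have "\<not> implicant n f (K - {l})"
        using f that by (simp add: prime_implicant_def)
      ultimately have "zeros n f \<inter> subcube n (K - {l}) \<noteq> {}"
        by (simp add: implicant_iff_zeros)
      then obtain x where x: "x \<in> zeros n f" "x \<in> subcube n (K - {l})"
        by blast
      \<comment> \<open>The subcube of \<open>K\<close> contains no zero, so a zero gained by
        deleting \<open>l\<close> must falsify \<open>l\<close>.\<close>
      have "x \<notin> subcube n K"
        using f x by (auto simp: prime_implicant_def implicant_iff_zeros)
      then have "x \<in> N l"
        using x by (auto simp: N_def subcube_def conj_true_def)
      then show ?thesis using x by blast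
    qed
    then obtain \<phi> where "\<forall>l\<in>K. \<phi> l \<in> N l \<and> \<phi> l \<in> zeros n f"
      by metis
    then show ?thesis
      by (intro bexI[of _ "restrict \<phi> K"]) (auto simp: F_def)
  qed
  then have "card {f \<in> P n k. prime_implicant n f K}
      \<le> card {Z. Z \<subseteq> cube n \<and> card Z = k \<and> (\<exists>\<phi>\<in>F. \<phi> ` K \<subseteq> Z)}"
    by (intro card_P_zeros_le)
  also have "{Z. Z \<subseteq> cube n \<and> card Z = k \<and> (\<exists>\<phi>\<in>F. \<phi> ` K \<subseteq> Z)}
      = (\<Union>\<phi>\<in>F. {Z. Z \<subseteq> cube n \<and> card Z = k \<and> \<phi> ` K \<subseteq> Z})"
    by auto
  also have "card \<dots> \<le> (\<Sum>\<phi>\<in>F. card {Z. Z \<subseteq> cube n \<and> card Z = k \<and> \<phi> ` K \<subseteq> Z})"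
    using finite_F by (rule card_UN_le)
  finally have "real (card {f \<in> P n k. prime_implicant n f K})
      \<le> (\<Sum>\<phi>\<in>F. real (card {Z. Z \<subseteq> cube n \<and> card Z = k \<and> \<phi> ` K \<subseteq> Z}))"
    by (simp only: of_nat_le_iff flip: of_nat_sum)
  also have "\<dots> \<le> (\<Sum>\<phi>\<in>F. real (card (P n k)) * (real k / 2 ^ n) ^ card K)"
  proof (rule sum_mono)
    fix \<phi> assume "\<phi> \<in> F"
    then show "real (card {Z. Z \<subseteq> cube n \<and> card Z = k \<and> \<phi> ` K \<subseteq> Z})
        \<le> real (card (P n k)) * (real k / 2 ^ n) ^ card K"
      using card_supersets_le[of "cube n" "\<phi> ` K" k] image k by (simp add: card_P)
  qed
  also have "\<dots> = real (card (P n k)) * (real k / 2 ^ card K) ^ card K"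
    by (simp add: card_F card_subcube_real[OF K] power_mult_distrib[symmetric])
  finally show ?thesis .
qed

text \<open>Union bound over the conjunctions of rank \<open>d\<close>, shared by the two instances
  \<open>implicant n\<close> and \<open>prime_implicant n\<close> of \<open>R\<close>.\<close>

lemma card_ex_conjunction_le:
  assumes "\<And>K. elementary_conjunction n K \<Longrightarrow> card K = d \<Longrightarrow> real (card {f \<in> P n k. R f K}) \<le> c"
    and "\<And>f K. R f K \<Longrightarrow> elementary_conjunction n K" and "c \<ge> 0"
  shows "real (card {f \<in> P n k. \<exists>K. R f K \<and> rank K = d}) \<le> (2 * real n) ^ d / fact d * c"
proof -
  have "{f \<in> P n k. \<exists>K. R f K \<and> rank K = d} \<subseteq> (\<Union>K\<in>conjunctions n d. {f \<in> P n k. R f K})"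
    using assms(2) by (auto simp: conjunctions_def)
  then have "card {f \<in> P n k. \<exists>K. R f K \<and> rank K = d} \<le> card (\<Union>K\<in>conjunctions n d. {f \<in> P n k. R f K})"
    by (intro card_mono) auto
  also have "\<dots> \<le> (\<Sum>K\<in>conjunctions n d. card {f \<in> P n k. R f K})"
    by (rule card_UN_le) simp
  finally have "real (card {f \<in> P n k. \<exists>K. R f K \<and> rank K = d})
      \<le> (\<Sum>K\<in>conjunctions n d. real (card {f \<in> P n k. R f K}))"
    by (simp only: of_nat_le_iff flip: of_nat_sum)
  also have "\<dots> \<le> (\<Sum>K\<in>conjunctions n d. c)"
    using assms(1) by (intro sum_mono) (auto simp: conjunctions_def rank_def)
  also have "\<dots> \<le> (2 * real n) ^ d / fact d * c"
    using mult_right_mono[OF card_conjunctions_le[of n d] \<open>c \<ge> 0\<close>] by simp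
  finally show ?thesis .
qed

text \<open>Combines the union bound with \<open>1 - x \<le> exp (- x)\<close>; the factor
  \<open>1 / fact d\<close> is estimated by 1.\<close>

lemma card_ex_implicant_le:
  assumes "n > 0"
  shows "real (card {f \<in> P n k. \<exists>K. implicant n f K \<and> rank K = d})
    \<le> real (card (P n k)) * exp (real d * ln (2 * real n) - real k / 2 ^ d)"
proof -
  have "(1 - 1 / 2 ^ d :: real) ^ k \<le> exp (- (1 / 2 ^ d)) ^ k"
    using exp_ge_add_one_self[of "- (1 / 2 ^ d) :: real"] by (intro power_mono) auto
  also have "\<dots> = exp (- (real k / 2 ^ d))"
    by (simp flip: exp_of_nat_mult)
  finally have exp: "(1 - 1 / 2 ^ d :: real) ^ k \<le> exp (- (real k / 2 ^ d))" .
  have "real (card {f \<in> P n k. \<exists>K. implicant n f K \<and> rank K = d})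
      \<le> (2 * real n) ^ d / fact d * (real (card (P n k)) * (1 - 1 / 2 ^ d) ^ k)"
    by (rule card_ex_conjunction_le) (use card_implicant_le in \<open>auto simp: implicant_def\<close>)
  also have "\<dots> \<le> (2 * real n) ^ d * (real (card (P n k)) * exp (- (real k / 2 ^ d)))"
    using exp divide_left_mono[of 1 "fact d" "(2 * real n) ^ d"]
    by (intro mult_mono mult_left_mono) auto
  also have "(2 * real n) ^ d = exp (real d * ln (2 * real n))"
    using assms by (simp add: exp_of_nat_mult)
  finally show ?thesis
    by (simp add: exp_diff exp_minus divide_inverse mult_ac)
qed

text \<open>A single term of the nonnegative series for \<open>exp d\<close> is at most the whole
  sum.\<close>

lemma power_self_le_exp_mult_fact: "real d ^ d \<le> exp 1 ^ d * fact d"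
proof -
  have "real d ^ d / fact d \<le> exp (real d)"
  proof -
    have s: "(\<lambda>i. inverse (fact i) * real d ^ i) sums exp (real d)"
      using exp_converges[of "real d"] by (simp add: scaleR_conv_of_real)
    have "(\<Sum>i\<in>{d}. inverse (fact i) * real d ^ i) \<le> exp (real d)"
      unfolding sums_unique[OF s] using s by (intro sum_le_suminf) (auto simp: sums_iff)
    then show ?thesis by (simp add: field_simps)
  qed
  then show ?thesis
    by (simp add: field_simps flip: exp_of_nat_mult)
qed

text \<open>Replacing \<open>1 / fact d\<close> by \<open>(exp 1 / d) ^ d\<close> makes the whole
  bound a \<open>d\<close>-th power, so that the ranks can later be summed geometrically.\<close>

lemma card_ex_prime_implicant_le:
  assumes "k \<le> 2 ^ n" "d > 0"
  shows "real (card {f \<in> P n k. \<exists>K. prime_implicant n f K \<and> rank K = d})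
    \<le> real (card (P n k)) * (2 * exp 1 * (real n * real k) / (real d * 2 ^ d)) ^ d"
proof -
  have "real (card {f \<in> P n k. \<exists>K. prime_implicant n f K \<and> rank K = d})
      \<le> (2 * real n) ^ d / fact d * (real (card (P n k)) * (real k / 2 ^ d) ^ d)"
    by (rule card_ex_conjunction_le)
      (use card_prime_implicant_le[OF _ assms(1)] in \<open>auto simp: prime_implicant_def implicant_def\<close>)
  also have "\<dots> = real (card (P n k)) * (2 * real n * real k / 2 ^ d) ^ d * (1 / fact d)"
    by (simp add: power_mult_distrib power_divide mult_ac)
  also have "\<dots> \<le> real (card (P n k)) * (2 * real n * real k / 2 ^ d) ^ d * (exp 1 / real d) ^ d"
    using power_self_le_exp_mult_fact[of d] assms(2)
    by (intro mult_left_mono) (auto simp: field_simps power_divide)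
  also have "\<dots> = real (card (P n k)) * (2 * exp 1 * (real n * real k) / (real d * 2 ^ d)) ^ d"
    by (simp add: power_mult_distrib power_divide mult_ac)
  finally show ?thesis .
qed

section \<open>Ranks outside the interval\<close>

text \<open>Write \<open>a = lg k\<close> and \<open>b = lg n\<close>. The coefficient 2 of the
  double logarithms gives \<open>k / 2 ^ d \<ge> a\<^sup>2 * b\<^sup>2\<close>, whereas the number
  of conjunctions contributes at most \<open>a * ln (2 * n)\<close> to the exponent. The square of
  \<open>b\<close> beats this and later also the number \<open>n + 1\<close> of ranks.\<close>

lemma card_low_rank_implicant_le:
  assumes n: "n \<ge> 2" and large: "ln (2 * real n) \<le> (lg (real n))\<^sup>2"
    and d: "real d < lg (real k) - 2 * (lg (lg (real k)) + lg (lg (real n)))"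
  shows "real (card {f \<in> P n k. \<exists>K. implicant n f K \<and> rank K = d})
    \<le> real (card (P n k)) * exp (ln (2 * real n) - (lg (real n))\<^sup>2)"
proof -
  define a b where "a = lg (real k)" and "b = lg (real n)"
  have b: "b \<ge> 1"
    using n by (simp add: b_def le_log_iff)
  have k: "k \<ge> 2"
  \<comment> \<open>Since \<open>lg 0 = 0\<close>, the lower end is at most 0 for
    \<open>k = 0\<close> and \<open>k = 1\<close>, so no rank lies below it.\<close>
  proof (rule ccontr)
    assume "\<not> k \<ge> 2"
    then have "k = 0 \<or> k = 1" by linarith
    then have "lg (real k) = 0" by (auto simp: log_def)
    moreover have "lg (0::real) = 0" by (simp add: log_def)
    moreover have "lg (lg (real n)) \<ge> 0" using b by (simp add: b_def)
    ultimately show False using d by simp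
  qed
  have a: "a \<ge> 1"
    using k by (simp add: a_def le_log_iff)
  have "real d \<le> a - 2 * lg a - 2 * lg b"
    using d by (simp add: a_def b_def)
  moreover have "lg a \<ge> 0" "lg b \<ge> 0"
    using a b by auto
  ultimately have d_le: "real d \<le> a" by linarith
  have "2 ^ d = 2 powr real d"
    by (simp add: powr_realpow)
  also have "\<dots> \<le> 2 powr (a - 2 * lg a - 2 * lg b)"
    using \<open>real d \<le> a - 2 * lg a - 2 * lg b\<close> by simp
  also have "\<dots> = 2 powr a / (2 powr lg a)\<^sup>2 / (2 powr lg b)\<^sup>2"
    by (simp add: powr_diff powr_powr powr_add power2_eq_square flip: powr_add)
  also have "\<dots> = real k / (a\<^sup>2 * b\<^sup>2)"
    using a b k by (simp add: a_def[symmetric]) (simp add: a_def)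
  finally have "a\<^sup>2 * b\<^sup>2 \<le> real k / 2 ^ d"
    using a b by (simp add: field_simps)
  moreover have "a * b\<^sup>2 \<le> a\<^sup>2 * b\<^sup>2"
    using a by (intro mult_right_mono) (auto simp: power2_eq_square)
  moreover have "real d * ln (2 * real n) \<le> a * ln (2 * real n)"
    using d_le n by (intro mult_right_mono) auto
  \<comment> \<open>Lowering the factor \<open>a\<close> to 1 makes the exponent independent of
    \<open>k\<close> and \<open>d\<close>.\<close>
  moreover have "a * (b\<^sup>2 - ln (2 * real n)) \<ge> 1 * (b\<^sup>2 - ln (2 * real n))"
    using a large by (intro mult_right_mono) (auto simp: b_def)
  ultimately have "real d * ln (2 * real n) - real k / 2 ^ d \<le> ln (2 * real n) - b\<^sup>2"
    by (simp add: algebra_simps)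
  then have "real (card (P n k)) * exp (real d * ln (2 * real n) - real k / 2 ^ d)
      \<le> real (card (P n k)) * exp (ln (2 * real n) - b\<^sup>2)"
    by (intro mult_left_mono) auto
  then show ?thesis
    using card_ex_implicant_le[of n k d] n by (simp add: b_def)
qed

text \<open>The inequality \<open>ln t \<le> t - 1\<close> is used twice: at
  \<open>t = x / 2\<close>, with \<open>ln 2 < 1\<close>, it gives \<open>ln x \<le> x / 2\<close>;
  at \<open>t = 1 / 2\<close> it gives \<open>ln 2 \<ge> 1 / 2\<close>.\<close>

lemma lg_le_self:
  assumes "x > 0"
  shows "lg x \<le> x"
proof -
  have "ln (x / 2) \<le> x / 2 - 1"
    using assms by (intro ln_le_minus_one) auto
  then have "ln x \<le> x / 2"
    using assms ln_2_less_1 by (simp add: ln_div)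
  also have "\<dots> \<le> x * ln 2"
    using assms ln_le_minus_one[of "1 / 2"] by (simp add: ln_div)
  finally show ?thesis
    by (simp add: log_def field_simps)
qed

text \<open>With \<open>L = lg (n * k) > 0\<close>, the hypothesis gives
  \<open>2 ^ d \<ge> n * k / sqrt L\<close> and, by \<open>lg_le_self\<close>,
  \<open>d \<ge> L / 2\<close>. Hence \<open>d * 2 ^ d\<close> exceeds \<open>n * k\<close> by a
  factor \<open>sqrt L / 2\<close>: half of the gain \<open>lg L\<close> moves the end of the
  interval, the other half makes the base of the power tend to 0.\<close>

lemma card_high_rank_prime_implicant_le:
  assumes n: "n \<ge> 2" and k: "k \<le> 2 ^ n"
    and d: "real d > lg (real n * real k) - lg (lg (real n * real k)) / 2"
  shows "d > 0"
    and "real (card {f \<in> P n k. \<exists>K. prime_implicant n f K \<and> rank K = d})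
      \<le> real (card (P n k)) * (4 * exp 1 / sqrt (lg (real n))) ^ d"
proof -
  define L where "L = lg (real n * real k)"
  have lg_n: "lg (real n) > 0"
    using n by auto
  have "d > 0 \<and> 2 * exp 1 * (real n * real k) / (real d * 2 ^ d) \<le> 4 * exp 1 / sqrt (lg (real n))"
  proof (cases "k = 0")
    \<comment> \<open>Since \<open>lg 0 = 0\<close>, the upper end is 0; thus \<open>d > 0\<close>,
      and the quotient vanishes.\<close>
    case True
    then show ?thesis
      using d lg_n by (simp add: log_def)
  next
    case False
    have "lg (real n) \<le> L"
      unfolding L_def using n False by (subst log_le_cancel_iff) (auto simp: mult_le_cancel_left1)
    then have L: "L > 0"
      using lg_n by linarith
    have d_ge: "real d \<ge> L / 2" and d_ge': "real d \<ge> L - lg L / 2"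
      using d lg_le_self[OF L] by (auto simp: L_def)
    have "real n * real k / sqrt L = 2 powr L / (2 powr lg L) powr (1 / 2)"
      using n False L by (simp add: L_def[symmetric] powr_half_sqrt) (simp add: L_def)
    also have "\<dots> = 2 powr (L - lg L / 2)"
      by (simp add: powr_diff powr_powr)
    also have "\<dots> \<le> 2 powr real d"
      using d_ge' by simp
    also have "\<dots> = 2 ^ d"
      by (simp add: powr_realpow)
    finally have "L / 2 * (real n * real k / sqrt L) \<le> real d * 2 ^ d"
      using d_ge L by (intro mult_mono) auto
    then have "2 * exp 1 * (real n * real k) / (real d * 2 ^ d)
        \<le> 2 * exp 1 * (real n * real k) / (L / 2 * (real n * real k / sqrt L))"
      using d_ge L n False by (intro divide_left_mono mult_pos_pos divide_pos_pos) auto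
    also have "\<dots> = 4 * exp 1 / (L / sqrt L)"
      using n False by simp
    also have "\<dots> = 4 * exp 1 / sqrt L"
      using L by (simp add: real_div_sqrt)
    also have "\<dots> \<le> 4 * exp 1 / sqrt (lg (real n))"
      using L lg_n \<open>lg (real n) \<le> L\<close> by (intro divide_left_mono) auto
    finally show ?thesis
      using d_ge L by auto
  qed
  then show "d > 0" and "real (card {f \<in> P n k. \<exists>K. prime_implicant n f K \<and> rank K = d})
      \<le> real (card (P n k)) * (4 * exp 1 / sqrt (lg (real n))) ^ d"
    using card_ex_prime_implicant_le[OF k, of d]
    by (auto elim!: order_trans intro!: mult_left_mono power_mono)
qed

section \<open>Summation over all ranks and passage to the limit\<close>

lemma sum_geometric_le:
  fixes q :: real
  assumes "0 \<le> q" "q \<le> 1 / 2"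
  shows "(\<Sum>d = 1..n. q ^ d) \<le> 2 * q"
proof -
  have "(\<Sum>d = 1..n. q ^ d) = q * (\<Sum>i<n. q ^ i)"
    by (simp add: sum_distrib_left sum.atLeast1_atMost_eq)
  also have "q * (\<Sum>i<n. q ^ i) \<le> q * 2"
  proof (rule mult_left_mono)
    have "(\<Sum>i<n. q ^ i) \<le> (\<Sum>i. q ^ i)"
      using assms by (intro sum_le_suminf summable_geometric) auto
    also have "\<dots> = 1 / (1 - q)"
      using assms by (intro suminf_geometric) auto
    also have "\<dots> \<le> 2"
      using assms by (simp add: field_simps)
    finally show "(\<Sum>i<n. q ^ i) \<le> 2" .
  qed fact
  finally show ?thesis by simp
qed

text \<open>Ranks below the interval are charged to implicants, ranks above it to prime implicants.
  The resulting relative bound depends on \<open>n\<close> only.\<close>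

lemma card_exceptional_le:
  fixes n k :: nat
  defines "q \<equiv> 4 * exp 1 / sqrt (lg (real n))"
  assumes n: "n \<ge> 2" and k: "k \<le> 2 ^ n"
    and large: "ln (2 * real n) \<le> (lg (real n))\<^sup>2" "q \<le> 1 / 2"
    and exceptional: "\<And>f. f \<in> B \<Longrightarrow> f \<in> P n k \<and> (\<exists>K. prime_implicant n f K \<and>
      real (rank K) \<notin> {lg (real k) - 2 * (lg (lg (real k)) + lg (lg (real n))) ..
        lg (real n * real k) - lg (lg (real n * real k)) / 2})"
  shows "real (card B) \<le> real (card (P n k))
    * ((real n + 1) * exp (ln (2 * real n) - (lg (real n))\<^sup>2) + 2 * q)"
proof -
  let ?lo = "lg (real k) - 2 * (lg (lg (real k)) + lg (lg (real n)))"
  let ?hi = "lg (real n * real k) - lg (lg (real n * real k)) / 2"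
  let ?e = "exp (ln (2 * real n) - (lg (real n))\<^sup>2)"
  \<comment> \<open>Rank 0 is left out of \<open>J\<close>, since a term \<open>q ^ 0\<close> would
    not tend to 0; the first claim of \<open>card_high_rank_prime_implicant_le\<close> justifies
    this.\<close>
  define I J where "I = {d \<in> {..n}. real d < ?lo}" and "J = {d \<in> {1..n}. real d > ?hi}"
  define F G where "F d = {f \<in> P n k. \<exists>K. implicant n f K \<and> rank K = d}"
    and "G d = {f \<in> P n k. \<exists>K. prime_implicant n f K \<and> rank K = d}" for d
  have q: "q \<ge> 0"
    using n by (simp add: q_def)
  have "B \<subseteq> (\<Union>d\<in>I. F d) \<union> (\<Union>d\<in>J. G d)"
  proof
    fix f assume "f \<in> B"
    then obtain K where f: "f \<in> P n k" and K: "prime_implicant n f K"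
      and rank: "real (rank K) < ?lo \<or> real (rank K) > ?hi"
      using exceptional[of f] by auto
    have "implicant n f K" and le: "rank K \<le> n"
      using K rank_le_if_elementary_conjunction by (auto simp: prime_implicant_def implicant_def)
    from rank show "f \<in> (\<Union>d\<in>I. F d) \<union> (\<Union>d\<in>J. G d)"
    proof
      assume "real (rank K) < ?lo"
      then have "rank K \<in> I" "f \<in> F (rank K)"
        using le f \<open>implicant n f K\<close> by (auto simp: I_def F_def)
      then show ?thesis by blast
    next
      assume hi: "real (rank K) > ?hi"
      then have "rank K \<in> J" "f \<in> G (rank K)"
        using le f K card_high_rank_prime_implicant_le(1)[OF n k hi] by (auto simp: J_def G_def)
      then show ?thesis by blast
    qed
  qed
  then have "card B \<le> card ((\<Union>d\<in>I. F d) \<union> (\<Union>d\<in>J. G d))"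
    by (intro card_mono) (auto simp: I_def J_def F_def G_def)
  also have "\<dots> \<le> card (\<Union>d\<in>I. F d) + card (\<Union>d\<in>J. G d)"
    by (rule card_Un_le)
  also have "\<dots> \<le> (\<Sum>d\<in>I. card (F d)) + (\<Sum>d\<in>J. card (G d))"
    by (intro add_mono card_UN_le) (auto simp: I_def J_def)
  finally have "real (card B) \<le> (\<Sum>d\<in>I. real (card (F d))) + (\<Sum>d\<in>J. real (card (G d)))"
    by (simp only: of_nat_le_iff flip: of_nat_sum of_nat_add)
  also have "\<dots> \<le> (\<Sum>d\<in>I. real (card (P n k)) * ?e) + (\<Sum>d\<in>J. real (card (P n k)) * q ^ d)"
    using card_low_rank_implicant_le[OF n large(1)] card_high_rank_prime_implicant_le(2)[OF n k]
    by (intro add_mono sum_mono) (auto simp: I_def J_def F_def G_def q_def)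
  also have "\<dots> \<le> (\<Sum>d\<in>{..n}. real (card (P n k)) * ?e) + (\<Sum>d\<in>{1..n}. real (card (P n k)) * q ^ d)"
    using q by (intro add_mono sum_mono2) (auto simp: I_def J_def)
  also have "\<dots> = real (card (P n k)) * ((real n + 1) * ?e + (\<Sum>d = 1..n. q ^ d))"
    by (simp add: algebra_simps sum_distrib_left)
  also have "\<dots> \<le> real (card (P n k)) * ((real n + 1) * ?e + 2 * q)"
    using sum_geometric_le[OF q large(2)] by (intro mult_left_mono add_mono) auto
  finally show ?thesis .
qed

theorem theorem1:
  fixes k :: "nat \<Rightarrow> nat"
  assumes "\<And>n. k n \<le> 2 ^ n"
  shows "\<exists>g h :: nat \<Rightarrow> real.
     g \<in> O(\<lambda>n. lg (lg (real (k n))) + lg (lg (real n))) \<and>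
     h \<in> \<Omega>(\<lambda>n. lg (lg (real n * real (k n)))) \<and>
     (\<forall>\<^sub>F n in sequentially. 0 \<le> h n) \<and>
     almost_all (\<lambda>n. P n (k n))
       (\<lambda>n f. \<forall>d :: nat.
          real d \<notin> {lg (real (k n)) + g n .. lg (real n * real (k n)) - h n} \<longrightarrow>
          \<not> (\<exists>D. is_dnf n f D \<and> (\<forall>K\<in>D. prime_implicant n f K) \<and> (\<exists>K\<in>D. rank K = d)))"
proof -
  \<comment> \<open>\<open>g\<close> and \<open>h\<close> are read off from the interval in
    \<open>card_exceptional_le\<close>; both are constant multiples of the functions they are
    compared with.\<close>
  define g where "g n = - 2 * (lg (lg (real (k n))) + lg (lg (real n)))" for n
  define h where "h n = lg (lg (real n * real (k n))) / 2" for n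
  define r where "r n = (real n + 1) * exp (ln (2 * real n) - (lg (real n))\<^sup>2)
    + 2 * (4 * exp 1 / sqrt (lg (real n)))" for n :: nat
  let ?Q = "\<lambda>n f. \<forall>d :: nat.
    real d \<notin> {lg (real (k n)) + g n .. lg (real n * real (k n)) - h n} \<longrightarrow>
    \<not> (\<exists>D. is_dnf n f D \<and> (\<forall>K\<in>D. prime_implicant n f K) \<and> (\<exists>K\<in>D. rank K = d))"
  have "g \<in> O(\<lambda>n. lg (lg (real (k n))) + lg (lg (real n)))"
    unfolding g_def by (subst landau_o.big.cmult_in_iff) simp_all
  moreover have "h \<in> \<Omega>(\<lambda>n. lg (lg (real n * real (k n))))"
    unfolding h_def by simp
  moreover have "\<forall>\<^sub>F n in sequentially. 0 \<le> h n"
    using eventually_ge_at_top[of 2]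
  proof eventually_elim
    case (elim n)
    show ?case
    proof (cases "k n = 0")
      \<comment> \<open>By \<open>lg 0 = 0\<close> both logarithms vanish, and
        \<open>h n = 0\<close>.\<close>
      case True
      then show ?thesis by (simp add: h_def log_def)
    next
      case False
      then have "2 * 1 \<le> real n * real (k n)"
        using elim by (intro mult_mono) auto
      then have "lg (real n * real (k n)) \<ge> 1"
        by (simp add: le_log_iff)
      then show ?thesis by (simp add: h_def)
    qed
  qed
  moreover have "almost_all (\<lambda>n. P n (k n)) ?Q"
    unfolding almost_all_def
  proof (rule tendsto_sandwich)
    show "\<forall>\<^sub>F n in sequentially. 0 \<le> real (card {f \<in> P n (k n). \<not> ?Q n f}) / real (card (P n (k n)))"
      by simp
    \<comment> \<open>The size conditions of \<open>card_exceptional_le\<close> hold eventually: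
      \<open>ln (2 * n)\<close> is only linear in \<open>lg n\<close>, and
      \<open>sqrt (lg n)\<close> diverges.\<close>
    have "\<forall>\<^sub>F n in sequentially. ln (2 * real n) \<le> (lg (real n))\<^sup>2"
      "\<forall>\<^sub>F n in sequentially. 4 * exp 1 / sqrt (lg (real n)) \<le> 1 / 2"
      by real_asymp+
    then show "\<forall>\<^sub>F n in sequentially. real (card {f \<in> P n (k n). \<not> ?Q n f}) / real (card (P n (k n))) \<le> r n"
      using eventually_ge_at_top[of 2]
    proof eventually_elim
      case (elim n)
      have "real (card {f \<in> P n (k n). \<not> ?Q n f}) \<le> real (card (P n (k n))) * r n"
        unfolding r_def
      proof (rule card_exceptional_le)
        \<comment> \<open>A function violating \<open>?Q\<close> has a prime implicant of rank
          outside the interval, namely the offending member of \<open>D\<close>.\<close>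
        fix f assume f: "f \<in> {f \<in> P n (k n). \<not> ?Q n f}"
        then obtain D K where "K \<in> D" "\<forall>K\<in>D. prime_implicant n f K"
          "real (rank K) \<notin> {lg (real (k n)) + g n .. lg (real n * real (k n)) - h n}"
          by blast
        with f show "f \<in> P n (k n) \<and> (\<exists>K. prime_implicant n f K \<and>
          real (rank K) \<notin> {lg (real (k n)) - 2 * (lg (lg (real (k n))) + lg (lg (real n))) ..
            lg (real n * real (k n)) - lg (lg (real n * real (k n))) / 2})"
          by (auto simp: g_def h_def)
      qed (use elim assms in auto)
      \<comment> \<open>\<open>k n \<le> 2 ^ n\<close> makes the class nonempty, so the bound may be
        divided by its size.\<close>
      moreover have "card (P n (k n)) > 0"
        using assms by (simp add: card_P)
      ultimately show ?case
        by (simp add: field_simps)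
    qed
    \<comment> \<open>\<open>(lg n)\<^sup>2\<close> outgrows \<open>ln (2 * n) + ln (n + 1)\<close>,
      and the other term is of order \<open>1 / sqrt (lg n)\<close>.\<close>
    show "r \<longlonglongrightarrow> 0"
      unfolding r_def by real_asymp
  qed simp
  ultimately show ?thesis by blast
qed

end
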